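(* Let $(\mathcal{T},\mathcal{H},\Lambda)$ be a space over a structured topological space $(\mathcal{H},\mathscr{S})$ such that the set of functions $H(\mathcal{T})$ is endowed with a compatible structure $\mathscr{Z}$ for which a structure basis exists, and let $P(\mathcal{T})$ denote the structure basis. Then $$\overline{P(\mathcal{T})}=H(\mathcal{T}),$$ where the closure is taken in the topology of pointwise convergence (that is, $f_\alpha\to f$ iff $f_\alpha(X)v\to f(X)v$ for all $X\in\mathcal{T}$, $v\in\mathcal{H}$).
   Context: A structured topological space $(\mathcal{H},\mathscr{S})$ is a topological space $\mathcal{H}$ together with a structure $\mathscr{S}$, i.e. a collection of subsets of the finite powers $\mathcal{H}^n$, such that (1) $S\in\mathscr{S}\Rightarrow\overline{S}\in\mathscr{S}$; (2) for each finite sequence of indices $i_1,\dots,i_n$ the block diagonal set $\{(v_{i_1},\dots,v_{i_n}) \mid v_i\in\mathcal{H}\}$ is in $\mathscr{S}$. Members of $\mathscr{S}$ are called structured. A structure is regular if it is closed under arbitrary intersections. $End(\mathcal{H})$ is the set of continuous maps $X:\mathcal{H}\to\mathcal{H}$ such that for all $m,n$ and all $S\in\mathscr{S}$ with $S\subseteq\mathcal{H}^{n+m+1}$ one has $(\mathrm{id}_{\mathcal{H}}^{\oplus m}\oplus X\oplus\mathrm{id}_{\mathcal{H}}^{\oplus n})S\in\mathscr{S}$ ($\oplus$ of maps acts coordinatewise). $End(\mathcal{H})$ has the topology of pointwise convergence. A space over $\mathcal{H}$ is a triple $(\mathcal{T},\mathcal{H},\Lambda)$ where $\mathcal{T}$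 is a set and $\Lambda$ is a collection of maps $\lambda:\mathcal{T}\to End(\mathcal{H})$ separating the points of $\mathcal{T}$; $\mathcal{T}$ is given the weak topology induced by $\Lambda$. For $X_1,\dots,X_n\in\mathcal{T}$, a set $S\subseteq\mathcal{H}^{nm}$ is jointly invariant for $\oplus_{i=1}^nX_i$ if $(\oplus_{i=1}^n\lambda(X_i))^{\oplus m}S\subseteq S$ for all $\lambda\in\Lambda$. $H(\mathcal{T})$ is the set of invariant structure preserving functions $f:\mathcal{T}\to End(\mathcal{H})$: for every $n\in\mathbb{N}$, all $X_1,\dots,X_n\in\mathcal{T}$ and every closed structured $S$ jointly invariant for $\oplus_{i=1}^nX_i$, the set $S$ is jointly invariant for $\oplus_{i=1}^nf(X_i)$, i.e. $(\oplus_{i=1}^n f(X_i))^{\oplus m}S\subseteq S$ when $S\subseteq\mathcal{H}^{nm}$. A compatible structure on $H(\mathcal{T})$ is a collection $\mathscr{Z}$ of subsets of the powers $H(\mathcal{T})^n$ such that: (1) $(H(\mathcal{T}),\mathscr{Z})$ is a structured topological space; (2) every $Z\in\mathscr{Z}$ is closed under pointwise composition; (3) every $Z\in\mathscr{Z}$ with $Z\subseteq H(\mathcal{T})^n$ contains $\mathrm{id}_{\mathcal{H}^n}$ (the $n$-tuple of constant functions equal to $\mathrm{id}_{\mathcal{H}}$); (4) for any $Z\in\mathscr{Z}$, $X_1,\dots,X_n\in\mathcal{T}$ and $v_1,\dots,v_n\in\mathcal{H}$, the set $\{\oplus_{i=1}^nf_i(X_i)v_i \mid \oplus_{i=1}^nf_i\in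 Z\}$ is in $\mathscr{S}$. A structure basis is a structured set of functions $\mathscr{B}$ (i.e. $\mathscr{B}\in\mathscr{Z}$) that contains the maps $\lambda\in\Lambda$. If $\mathscr{Z}$ is regular, there is a unique smallest structure basis, and $P(\mathcal{T})$ denotes it; otherwise $P(\mathcal{T})$ denotes some structure basis.
   Formalization: Condition (4) of a compatible structure is strengthened: a structured Z in H(T)^n must give structured sets when evaluated at nm points and vectors (m-fold repetition, every m), not only at n; with n points only, the claim is false (a four-point discrete H gives a counterexample). *)

theory Defs
  imports "HOL-Analysis.Function_Topology"
begin

text \<open>The power $X^n$ consists of the extensional functions on $\{0,\dots,n-1\}$. A structure is
  given as a family indexed by the exponent, \<open>\<S> n\<close> being the collection of structured
  subsets of $X^n$.\<close>

definition power_space :: "'a topology \<Rightarrow> nat \<Rightarrow> (nat \<Rightarrow> 'a) topology" where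
  "power_space X n = product_topology (\<lambda>_. X) {..<n}"

definition block_diagonal :: "'a set \<Rightarrow> nat \<Rightarrow> (nat \<Rightarrow> nat) \<Rightarrow> (nat \<Rightarrow> 'a) set" where
  "block_diagonal A n idx = {(\<lambda>j\<in>{..<n}. v (idx j)) | v. \<forall>i. v i \<in> A}"

definition structured_space :: "'a topology \<Rightarrow> (nat \<Rightarrow> (nat \<Rightarrow> 'a) set set) \<Rightarrow> bool" where
  "structured_space X \<S> \<longleftrightarrow>
     (\<forall>n. \<forall>S\<in>\<S> n. S \<subseteq> topspace (power_space X n)) \<and>
     (\<forall>n. \<forall>S\<in>\<S> n. power_space X n closure_of S \<in> \<S> n) \<and>
     (\<forall>n idx. block_diagonal (topspace X) n idx \<in> \<S> n)"

text \<open>Intersections are taken within one power. The empty intersection, $X^n$ itself, is a block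
  diagonal set and hence always structured.\<close>

definition regular_structure :: "(nat \<Rightarrow> (nat \<Rightarrow> 'a) set set) \<Rightarrow> bool" where
  "regular_structure \<S> \<longleftrightarrow> (\<forall>n \<C>. \<C> \<subseteq> \<S> n \<longrightarrow> \<C> \<noteq> {} \<longrightarrow> \<Inter>\<C> \<in> \<S> n)"

definition oplus :: "nat \<Rightarrow> (nat \<Rightarrow> 'a \<Rightarrow> 'b) \<Rightarrow> (nat \<Rightarrow> 'a) \<Rightarrow> (nat \<Rightarrow> 'b)" where
  "oplus n F v = (\<lambda>i\<in>{..<n}. F i (v i))"

definition End_space :: "(nat \<Rightarrow> (nat \<Rightarrow> 'h::topological_space) set set) \<Rightarrow> ('h \<Rightarrow> 'h) set" where
  "End_space \<S> = {X. continuous_on UNIV X \<and>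
     (\<forall>m n. \<forall>S\<in>\<S> (n + m + 1).
        oplus (n + m + 1) (\<lambda>i. if i = m then X else id) ` S \<in> \<S> (n + m + 1))}"

definition space_over ::
  "(nat \<Rightarrow> (nat \<Rightarrow> 'h::topological_space) set set) \<Rightarrow> ('t \<Rightarrow> 'h \<Rightarrow> 'h) set \<Rightarrow> bool" where
  "space_over \<S> \<Lambda> \<longleftrightarrow>
     (\<forall>l\<in>\<Lambda>. \<forall>X. l X \<in> End_space \<S>) \<and>
     (\<forall>X Y. X \<noteq> Y \<longrightarrow> (\<exists>l\<in>\<Lambda>. l X \<noteq> l Y))"

text \<open>For $S \subseteq H^{nm} = (H^n)^m$, the map $(\oplus_{i<n} F_i)^{\oplus m}$ acts on coordinate
  $i < nm$ through $F_{i \bmod n}$. Only the values of \<open>X\<close> below \<open>n\<close> matter.\<close>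

definition jointly_invariant ::
  "('t \<Rightarrow> 'h \<Rightarrow> 'h) set \<Rightarrow> nat \<Rightarrow> nat \<Rightarrow> (nat \<Rightarrow> 't) \<Rightarrow> (nat \<Rightarrow> 'h) set \<Rightarrow> bool" where
  "jointly_invariant \<Lambda> n m X S \<longleftrightarrow>
     (\<forall>l\<in>\<Lambda>. oplus (n * m) (\<lambda>i. l (X (i mod n))) ` S \<subseteq> S)"

definition isp_functions ::
  "(nat \<Rightarrow> (nat \<Rightarrow> 'h::topological_space) set set) \<Rightarrow> ('t \<Rightarrow> 'h \<Rightarrow> 'h) set \<Rightarrow> ('t \<Rightarrow> 'h \<Rightarrow> 'h) set" where
  "isp_functions \<S> \<Lambda> = {f. (\<forall>X. f X \<in> End_space \<S>) \<and>
     (\<forall>n m X. \<forall>S\<in>\<S> (n * m).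
        closedin (power_space euclidean (n * m)) S \<longrightarrow>
        jointly_invariant \<Lambda> n m X S \<longrightarrow> jointly_invariant {f} n m X S)}"

text \<open>The topology of the function type \<open>'t \<Rightarrow> 'h \<Rightarrow> 'h\<close> is the product topology, i.e. the topology
  of pointwise convergence.

  In the last clause the number of points \<open>X i\<close> and vectors \<open>v i\<close> may be any multiple \<open>n * m\<close> of the
  arity \<open>n\<close> of \<open>Z\<close>: as in joint invariance, an \<open>n\<close>-tuple of functions acts on \<open>n * m\<close> coordinates by
  \<open>m\<close>-fold repetition. Thus a set \<open>Z\<close> of single functions may be evaluated at any number of points.
  Asking this for \<open>m = 1\<close> only would not suffice for the density of a structure basis.\<close>

definition compatible_structure ::
  "(nat \<Rightarrow> (nat \<Rightarrow> 'h::topological_space) set set) \<Rightarrow> ('t \<Rightarrow> 'h \<Rightarrow> 'h) set \<Rightarrow>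
   (nat \<Rightarrow> (nat \<Rightarrow> 't \<Rightarrow> 'h \<Rightarrow> 'h) set set) \<Rightarrow> bool" where
  "compatible_structure \<S> \<Lambda> \<Z> \<longleftrightarrow>
     structured_space (top_of_set (isp_functions \<S> \<Lambda>)) \<Z> \<and>
     (\<forall>n. \<forall>Z\<in>\<Z> n. \<forall>f\<in>Z. \<forall>g\<in>Z. (\<lambda>i\<in>{..<n}. \<lambda>X. f i X \<circ> g i X) \<in> Z) \<and>
     (\<forall>n. \<forall>Z\<in>\<Z> n. (\<lambda>i\<in>{..<n}. \<lambda>X. id) \<in> Z) \<and>
     (\<forall>n m X v. \<forall>Z\<in>\<Z> n.
        {(\<lambda>i\<in>{..<n * m}. f (i mod n) (X i) (v i)) | f. f \<in> Z} \<in> \<S> (n * m))"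

definition structure_basis ::
  "('t \<Rightarrow> 'h \<Rightarrow> 'h) set \<Rightarrow> (nat \<Rightarrow> (nat \<Rightarrow> 't \<Rightarrow> 'h \<Rightarrow> 'h) set set) \<Rightarrow> ('t \<Rightarrow> 'h \<Rightarrow> 'h) set \<Rightarrow> bool" where
  "structure_basis \<Lambda> \<Z> B \<longleftrightarrow> {(\<lambda>i\<in>{..<1}. f) | f. f \<in> B} \<in> \<Z> 1 \<and> \<Lambda> \<subseteq> B"

text \<open>The sets which $P(\mathcal{T})$ may denote.\<close>

definition chosen_structure_basis ::
  "('t \<Rightarrow> 'h \<Rightarrow> 'h) set \<Rightarrow> (nat \<Rightarrow> (nat \<Rightarrow> 't \<Rightarrow> 'h \<Rightarrow> 'h) set set) \<Rightarrow> ('t \<Rightarrow> 'h \<Rightarrow> 'h) set \<Rightarrow> bool" where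
  "chosen_structure_basis \<Lambda> \<Z> P \<longleftrightarrow> structure_basis \<Lambda> \<Z> P \<and>
     (regular_structure \<Z> \<longrightarrow> (\<forall>B. structure_basis \<Lambda> \<Z> B \<longrightarrow> P \<subseteq> B))"

end

theory Submission
  imports Defs
begin

text \<open>A basic neighbourhood of a function \<open>h\<close> in $H(\mathcal{T})$ constrains the values of \<open>h\<close> at
  finitely many pairs $(X_1, v_1), \dots, (X_N, v_N)$ only. The orbit
  $S = \{(f(X_1)v_1, \dots, f(X_N)v_N) \mid f \in P\}$ collects what the basis can do at these pairs,
  and density says that the tuple $(h(X_i)v_i)_i$ lies in $\overline{S}$. This is the commutant
  argument of the von Neumann double commutant theorem: $S$ is structured because the structure on
  $H(\mathcal{T})$ is compatible, and hence so is $\overline{S}$; since $P$ contains $\Lambda$ and is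
  closed under composition, each $\bigoplus_i \lambda(X_i)$ maps $S$ into itself, and by continuity
  $\overline{S}$ too (\<open>jointly_invariant_closure_of\<close>). So \<open>h\<close>, being invariant structure preserving,
  also leaves $\overline{S}$ invariant (\<open>isp_functions_preserves_orbit_closure\<close>). As $P$ contains the
  constant function $\mathrm{id}$, the tuple $(v_i)_i$ lies in $S$, and its image
  $(h(X_i)v_i)_i$ therefore lies in $\overline{S}$.\<close>

lemma open_fun_contains_box:
  fixes U :: "('a \<Rightarrow> 'b::topological_space) set"
  assumes "open U" and "f \<in> U"
  shows "\<exists>V. finite {x. V x \<noteq> UNIV} \<and> (\<forall>x. open (V x)) \<and> (\<forall>x. f x \<in> V x) \<and> Pi UNIV V \<subseteq> U"
proof -
  have "openin (product_topology (\<lambda>_::'a. euclidean :: 'b topology) UNIV) U"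
    using assms(1) by (simp add: open_fun_def)
  then obtain V where "finite {x. V x \<noteq> UNIV}" "\<forall>x. open (V x)" "f \<in> Pi UNIV V" "Pi UNIV V \<subseteq> U"
    using assms(2) unfolding openin_product_topology_alt by (fastforce simp: PiE_UNIV_domain)
  then show ?thesis
    by (intro exI[of _ V]) auto
qed

text \<open>Pointwise convergence is the product topology taken twice, so a basic neighbourhood in the
  outer product has to be refined by basic neighbourhoods in the finitely many inner factors.\<close>

lemma open_curried_finite_constraints:
  fixes U :: "('a \<Rightarrow> 'b \<Rightarrow> 'c::topological_space) set"
  assumes "open U" and "f \<in> U"
  obtains D W where "finite D"
    and "\<forall>x y. open (W x y)" and "\<forall>x y. f x y \<in> W x y"
    and "\<forall>g. (\<forall>(x, y)\<in>D. g x y \<in> W x y) \<longrightarrow> g \<in> U"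
proof -
  obtain V where V: "finite {x. V x \<noteq> UNIV}" "\<And>x. open (V x)" "\<And>x. f x \<in> V x"
    and V_sub: "Pi UNIV V \<subseteq> U"
    using open_fun_contains_box[OF assms] by metis
  have "\<exists>W. finite {y. W y \<noteq> UNIV} \<and> (\<forall>y. open (W y)) \<and> (\<forall>y. f x y \<in> W y) \<and> Pi UNIV W \<subseteq> V x"
    for x
    by (rule open_fun_contains_box[OF V(2,3)])
  then obtain W where W: "\<And>x. finite {y. W x y \<noteq> UNIV}" "\<And>x y. open (W x y)"
    "\<And>x y. f x y \<in> W x y" and W_sub: "\<And>x. Pi UNIV (W x) \<subseteq> V x"
    by metis
  show thesis
  proof
    let ?D = "SIGMA x:{x. V x \<noteq> UNIV}. {y. W x y \<noteq> UNIV}"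
    show "finite ?D"
      using V(1) W(1) by (rule finite_SigmaI)
    show "\<forall>x y. open (W x y)" and "\<forall>x y. f x y \<in> W x y"
      using W by blast+
    show "\<forall>g. (\<forall>(x, y)\<in>?D. g x y \<in> W x y) \<longrightarrow> g \<in> U"
    proof (intro allI impI)
      fix g
      assume g: "\<forall>(x, y)\<in>?D. g x y \<in> W x y"
      have "g x \<in> V x" for x
      proof (cases "V x = UNIV")
        case False
        then have "g x \<in> Pi UNIV (W x)"
          using g by blast
        then show ?thesis
          using W_sub by blast
      qed simp
      then show "g \<in> U"
        using V_sub by blast
    qed
  qed
qed

lemma continuous_map_oplus:
  assumes "\<And>i. i < n \<Longrightarrow> continuous_map X Y (F i)"
  shows "continuous_map (power_space X n) (power_space Y n) (oplus n F)"
  unfolding power_space_def oplus_def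
proof (subst continuous_map_componentwise, intro conjI ballI)
  fix i
  assume i: "i \<in> {..<n}"
  have "continuous_map (product_topology (\<lambda>_. X) {..<n}) Y (F i \<circ> (\<lambda>v. v i))"
    using assms i by (intro continuous_map_compose[OF continuous_map_product_projection]) auto
  then show "continuous_map (product_topology (\<lambda>_. X) {..<n}) Y
      (\<lambda>v. (\<lambda>i\<in>{..<n}. F i (v i)) i)"
    using i by (simp add: o_def)
qed auto

lemma jointly_invariant_closure_of:
  fixes S :: "(nat \<Rightarrow> 'h::topological_space) set"
  assumes "jointly_invariant \<Lambda> n m X S"
    and "\<And>l X. l \<in> \<Lambda> \<Longrightarrow> continuous_on UNIV (l X)"
  shows "jointly_invariant \<Lambda> n m X (power_space euclidean (n * m) closure_of S)"
  unfolding jointly_invariant_def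
proof
  fix l
  assume l: "l \<in> \<Lambda>"
  let ?T = "power_space (euclidean :: 'h topology) (n * m)"
  let ?F = "oplus (n * m) (\<lambda>i. l (X (i mod n)))"
  have "continuous_map ?T ?T ?F"
    using assms(2)[OF l] by (intro continuous_map_oplus) simp
  then have "?F ` (?T closure_of S) \<subseteq> ?T closure_of (?F ` S)"
    by (rule continuous_map_image_closure_subset)
  also have "\<dots> \<subseteq> ?T closure_of S"
    using assms(1) l by (intro closure_of_mono) (auto simp: jointly_invariant_def)
  finally show "?F ` (?T closure_of S) \<subseteq> ?T closure_of S" .
qed

text \<open>Singleton tuples only serve to place a set of functions in the first power of
  $H(\mathcal{T})$; stripping them off turns the axioms of a compatible structure into statements
  about $P$ itself. An orbit along any number \<open>N\<close> of pairs comes from arity one, repeated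
  \<open>N\<close> times.\<close>

lemma structure_basis_properties:
  assumes "compatible_structure \<S> \<Lambda> \<Z>" and "structure_basis \<Lambda> \<Z> P"
  shows "P \<subseteq> isp_functions \<S> \<Lambda>"
    and "(\<lambda>X. id) \<in> P"
    and "\<And>f g. f \<in> P \<Longrightarrow> g \<in> P \<Longrightarrow> (\<lambda>X. f X \<circ> g X) \<in> P"
    and "\<And>N X v. {(\<lambda>i\<in>{..<N}. f (X i) (v i)) | f. f \<in> P} \<in> \<S> N"
proof -
  define Z where "Z = {(\<lambda>i\<in>{..<1::nat}. f) | f. f \<in> P}"
  have Z: "Z \<in> \<Z> 1"
    using assms(2) by (simp add: structure_basis_def Z_def)
  have tuple_iff: "(\<lambda>i\<in>{..<1::nat}. f) \<in> Z \<longleftrightarrow> f \<in> P" for f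
  proof -
    have "f = g" if "(\<lambda>i\<in>{..<1::nat}. f) = (\<lambda>i\<in>{..<1}. g)" for g
      using fun_cong[OF that, of 0] by simp
    then show ?thesis
      unfolding Z_def by blast
  qed
  note compatible = assms(1)[unfolded compatible_structure_def]
  note structured = compatible[THEN conjunct1, unfolded structured_space_def, THEN conjunct1]
  note composition = compatible[THEN conjunct2, THEN conjunct1]
  note identity = compatible[THEN conjunct2, THEN conjunct2, THEN conjunct1]
  note evaluation = compatible[THEN conjunct2, THEN conjunct2, THEN conjunct2]
  show "P \<subseteq> isp_functions \<S> \<Lambda>"
  proof
    fix f
    assume "f \<in> P"
    then have "(\<lambda>i\<in>{..<1::nat}. f) \<in> topspace (power_space (top_of_set (isp_functions \<S> \<Lambda>)) 1)"
      using structured[THEN spec, THEN bspec, OF Z] tuple_iff by blast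
    then show "f \<in> isp_functions \<S> \<Lambda>"
      by (simp add: power_space_def PiE_iff)
  qed
  show "(\<lambda>X. id) \<in> P"
    using identity[THEN spec, THEN bspec, OF Z] by (simp only: tuple_iff)
  show "(\<lambda>X. f X \<circ> g X) \<in> P" if "f \<in> P" "g \<in> P" for f g
  proof -
    have "(\<lambda>i\<in>{..<1}. f) \<in> Z" and "(\<lambda>i\<in>{..<1}. g) \<in> Z"
      using that by (simp_all only: tuple_iff)
    then have "(\<lambda>i\<in>{..<1}. \<lambda>X. (\<lambda>i\<in>{..<1::nat}. f) i X \<circ> (\<lambda>i\<in>{..<1::nat}. g) i X) \<in> Z"
      by (rule composition[THEN spec, THEN bspec, OF Z, THEN bspec, THEN bspec])
    also have "(\<lambda>i\<in>{..<1}. \<lambda>X. (\<lambda>i\<in>{..<1::nat}. f) i X \<circ> (\<lambda>i\<in>{..<1::nat}. g) i X)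
        = (\<lambda>i\<in>{..<1}. \<lambda>X. f X \<circ> g X)"
      by (rule restrict_ext) simp
    finally show ?thesis
      by (simp only: tuple_iff)
  qed
  fix N X v
  have "{(\<lambda>i\<in>{..<1 * N}. f (i mod 1) (X i) (v i)) | f. f \<in> Z} \<in> \<S> (1 * N)"
    by (rule evaluation[rule_format, OF Z])
  also have "{(\<lambda>i\<in>{..<1 * N}. f (i mod 1) (X i) (v i)) | f. f \<in> Z}
      = (\<lambda>f. \<lambda>i\<in>{..<1 * N}. f (i mod 1) (X i) (v i)) ` (\<lambda>f. \<lambda>i\<in>{..<1}. f) ` P"
    unfolding Z_def by blast
  also have "\<dots> = (\<lambda>f. \<lambda>i\<in>{..<N}. f (X i) (v i)) ` P"
    by (simp add: image_image)
  also have "\<dots> = {(\<lambda>i\<in>{..<N}. f (X i) (v i)) | f. f \<in> P}"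
    by blast
  finally show "{(\<lambda>i\<in>{..<N}. f (X i) (v i)) | f. f \<in> P} \<in> \<S> N"
    by simp
qed

text \<open>The sets on which \<open>h\<close> is tested by joint invariance may have several blocks; one block,
  with one point \<open>X i\<close> per coordinate, is enough here.\<close>

lemma isp_functions_preserves_orbit_closure:
  fixes \<S> :: "nat \<Rightarrow> (nat \<Rightarrow> 'h::topological_space) set set"
    and X :: "nat \<Rightarrow> 't" and v :: "nat \<Rightarrow> 'h"
  assumes \<S>: "structured_space (euclidean :: 'h topology) \<S>"
    and "space_over \<S> \<Lambda>"
    and "\<Lambda> \<subseteq> P"
    and id: "(\<lambda>X. id) \<in> P"
    and comp: "\<And>f g. f \<in> P \<Longrightarrow> g \<in> P \<Longrightarrow> (\<lambda>X. f X \<circ> g X) \<in> P"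
    and orbit: "{(\<lambda>i\<in>{..<N}. f (X i) (v i)) | f. f \<in> P} \<in> \<S> N"
    and "h \<in> isp_functions \<S> \<Lambda>"
  shows "(\<lambda>i\<in>{..<N}. h (X i) (v i))
    \<in> power_space euclidean N closure_of {(\<lambda>i\<in>{..<N}. f (X i) (v i)) | f. f \<in> P}"
proof -
  define S where "S = {(\<lambda>i\<in>{..<N}. f (X i) (v i)) | f. f \<in> P}"
  let ?T = "power_space (euclidean :: 'h topology) N"
  let ?v = "\<lambda>i\<in>{..<N}. v i"
  have "jointly_invariant \<Lambda> N 1 X S"
    unfolding jointly_invariant_def
  proof (intro ballI image_subsetI)
    fix l s
    assume l: "l \<in> \<Lambda>" and "s \<in> S"
    then obtain f where f: "f \<in> P" "s = (\<lambda>i\<in>{..<N}. f (X i) (v i))"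
      by (auto simp: S_def)
    then have "oplus (N * 1) (\<lambda>i. l (X (i mod N))) s = (\<lambda>i\<in>{..<N}. (l (X i) \<circ> f (X i)) (v i))"
      by (auto simp: oplus_def)
    moreover have "(\<lambda>X. l X \<circ> f X) \<in> P"
      using comp l f(1) \<open>\<Lambda> \<subseteq> P\<close> by blast
    ultimately show "oplus (N * 1) (\<lambda>i. l (X (i mod N))) s \<in> S"
      unfolding S_def by (intro CollectI exI[of _ "\<lambda>X. l X \<circ> f X"]) simp
  qed
  moreover have "continuous_on UNIV (l Y)" if "l \<in> \<Lambda>" for l Y
    using \<open>space_over \<S> \<Lambda>\<close> that by (auto simp: space_over_def End_space_def)
  ultimately have inv: "jointly_invariant \<Lambda> N 1 X (?T closure_of S)"
    using jointly_invariant_closure_of[of \<Lambda> N 1 X S] by simp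
  have S: "S \<in> \<S> N"
    using orbit by (simp add: S_def)
  then have "?T closure_of S \<in> \<S> (N * 1)"
    using \<S> by (simp add: structured_space_def)
  moreover have "closedin (power_space euclidean (N * 1)) (?T closure_of S)"
    by simp
  ultimately have "jointly_invariant {h} N 1 X (?T closure_of S)"
    using \<open>h \<in> isp_functions \<S> \<Lambda>\<close> inv unfolding isp_functions_def by blast
  moreover have "?v \<in> ?T closure_of S"
  proof -
    have "?v \<in> S"
      using id unfolding S_def by (intro CollectI exI[of _ "\<lambda>X. id"]) simp
    then show ?thesis
      using S \<S> closure_of_subset[of S ?T] by (auto simp: structured_space_def)
  qed
  ultimately have "oplus (N * 1) (\<lambda>i. h (X (i mod N))) ?v \<in> ?T closure_of S"
    by (auto simp: jointly_invariant_def)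
  also have "oplus (N * 1) (\<lambda>i. h (X (i mod N))) ?v = (\<lambda>i\<in>{..<N}. h (X i) (v i))"
    by (auto simp: oplus_def)
  finally show ?thesis
    unfolding S_def .
qed

theorem theorem2p25:
  fixes \<S> :: "nat \<Rightarrow> (nat \<Rightarrow> 'h::topological_space) set set"
    and \<Lambda> P :: "('t \<Rightarrow> 'h \<Rightarrow> 'h) set"
    and \<Z> :: "nat \<Rightarrow> (nat \<Rightarrow> 't \<Rightarrow> 'h \<Rightarrow> 'h) set set"
  assumes "structured_space (euclidean :: 'h topology) \<S>"
    and "space_over \<S> \<Lambda>"
    and "compatible_structure \<S> \<Lambda> \<Z>"
    and "chosen_structure_basis \<Lambda> \<Z> P"
  shows "top_of_set (isp_functions \<S> \<Lambda>) closure_of P = isp_functions \<S> \<Lambda>"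
proof (intro subset_antisym subsetI)
  let ?H = "isp_functions \<S> \<Lambda>"
  have basis: "structure_basis \<Lambda> \<Z> P"
    using assms(4) by (simp add: chosen_structure_basis_def)
  then have "\<Lambda> \<subseteq> P"
    by (simp add: structure_basis_def)
  note P = structure_basis_properties[OF assms(3) basis]
  show "h \<in> ?H" if "h \<in> top_of_set ?H closure_of P" for h
    using that by (simp add: in_closure_of)
  fix h
  assume h: "h \<in> ?H"
  have "\<exists>f\<in>P. f \<in> U" if "open U" "h \<in> U" for U
  proof -
    obtain D W where D: "finite D"
      and W: "\<forall>Y w. open (W Y w)" "\<forall>Y w. h Y w \<in> W Y w"
      and U: "\<forall>g. (\<forall>(Y, w)\<in>D. g Y w \<in> W Y w) \<longrightarrow> g \<in> U"
      by (rule open_curried_finite_constraints[OF \<open>open U\<close> \<open>h \<in> U\<close>])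
    obtain p where p: "bij_betw p {..<card D} D"
      using ex_bij_betw_nat_finite[OF D] by (auto simp: atLeast0LessThan)
    let ?N = "card D" and ?X = "\<lambda>i. fst (p i)" and ?v = "\<lambda>i. snd (p i)"
    let ?box = "\<Pi>\<^sub>E i\<in>{..<?N}. W (?X i) (?v i)"
    have "(\<lambda>i\<in>{..<?N}. h (?X i) (?v i))
        \<in> power_space euclidean ?N closure_of {(\<lambda>i\<in>{..<?N}. f (?X i) (?v i)) | f. f \<in> P}"
      by (rule isp_functions_preserves_orbit_closure
          [OF assms(1,2) \<open>\<Lambda> \<subseteq> P\<close> P(2) P(3) P(4) h])
    moreover have "openin (power_space euclidean ?N) ?box"
      unfolding power_space_def using W(1) by (simp add: openin_PiE)
    moreover have "(\<lambda>i\<in>{..<?N}. h (?X i) (?v i)) \<in> ?box"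
      using W(2) by auto
    ultimately obtain f where f: "f \<in> P" "(\<lambda>i\<in>{..<?N}. f (?X i) (?v i)) \<in> ?box"
      unfolding in_closure_of by blast
    have "f Y w \<in> W Y w" if "(Y, w) \<in> D" for Y w
    proof -
      have "(Y, w) \<in> p ` {..<?N}"
        using bij_betw_imp_surj_on[OF p] that by simp
      then obtain i where i: "i < ?N" "p i = (Y, w)"
        by auto
      then show ?thesis
        using PiE_mem[OF f(2), of i] by simp
    qed
    then show ?thesis
      using U[rule_format, of f] f(1) by auto
  qed
  then show "h \<in> top_of_set ?H closure_of P"
    using h P(1) by (fastforce simp: in_closure_of openin_open)
qed

end
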